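(* Let $\mathcal F$ be a finite reduced collection of forbidden words over $\Sigma$ with $\Sigma_{\mathcal F}$ irreducible, and let $p$ be the length of the longest word in $\mathcal F$. Set $\mathcal R=\mathcal L_p$, with all words in $\mathcal R$ assigned the same multiplicity $M\ge2$. Let $A$ be the adjacency matrix associated with $\mathcal F$ and $\mathcal R$, and $\Sigma_A$ the corresponding edge shift. Then the Parry measure on $\Sigma_{\mathcal F}^{[p]}$ is the push forward of the Shannon–Parry measure on $\Sigma_A$ under $\pi:\Sigma_A\to\Sigma_{\mathcal F}^{[p]}$.
   Context: $\Sigma$ is a finite symbol set. A collection of words is reduced if for any two distinct words in it neither is a (contiguous) subword of the other. $\mathcal F$ is a finite reduced collection of words of length at least $2$; $\Sigma_{\mathcal F}\subseteq\Sigma^{\mathbb N}$ is the set of one-sided sequences containing no word of $\mathcal F$. A word is allowed if it is a subword of some sequence in $\Sigma_{\mathcal F}$; $\mathcal L_n$ is the set of allowed words of length $n$. All symbols are assumed allowed. $\Sigma_{\mathcal F}$ is irreducible: for all allowed $u,v$ there is a word $w$ with $uwv$ allowed. For $X=x_1\dots x_{p-1}$, $Y=y_1\dots y_{p-1}$ in $\mathcal L_{p-1}$, $X*Y$ is defined only if $x_2\dots x_{p-1}=y_1\dots y_{p-2}$ (no condition if $p=2$), and then $X*Y=x_1\dots x_{p-1}y_{p-1}$. For a collection $\mathcal R=\{r_1(m_1),\dots,r_\ell(m_\ell)\}$ of allowed words, all of length $p$, with integer multiplicities $m_i\ge2$, the adjacency matrix $A$ associated with $\mathcal F$ and $\mathcal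 R$ is indexed by $\mathcal L_{p-1}$, with $A_{XY}$ equal to the multiplicity of $X*Y$ if $X*Y\in\mathcal L_p$ (namely $m_i$ if $X*Y=r_i$, and $1$ if $X*Y\notin\mathcal R$), and $A_{XY}=0$ otherwise. $\Sigma_A$ is the set of one-sided infinite paths of edges in the directed multigraph with vertex set $\mathcal L_{p-1}$ and edges $(X*Y)_1,\dots,(X*Y)_{A_{XY}}$ from $X$ to $Y$. $\Sigma_{\mathcal F}^{[p]}$ is the $p$-block presentation of $\Sigma_{\mathcal F}$ (image under $x_1x_2\dots\mapsto(x_1\dots x_p)(x_2\dots x_{p+1})\dots$); it is the edge shift of the binary matrix $\hat A$ indexed by $\mathcal L_{p-1}$ with $\hat A_{XY}=1$ iff $A_{XY}>0$, with symbols $X*Y\in\mathcal L_p$. The map $\pi$ is $\pi((X_1*X_2)_{i_1}(X_2*X_3)_{i_2}\dots)=(X_1*X_2)(X_2*X_3)\dots$. For an irreducible non-negative integer matrix $B$ indexed by $\mathcal L_{p-1}$ with Perron root $\theta$ and left and right Perron eigenvectors $U,V$ normalized by $U^TV=1$, the Shannon–Parry measure on the edge shift $\Sigma_B$ is the measure with $\mu(C_W)=U_{X_1}V_{X_{n+1}}/\theta^n$ for every word $W$ of $\Sigma_B$ that is a path of $n$ edges with vertices $X_1,\dots,X_{n+1}$, where $C_W$ is the set of sequences in $\Sigma_B$ beginning with $W$. For $B=\hat A$ binary it is called the Parry measure on $\Sigma_{\mathcal F}^{[p]}$. *)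

theory Defs
  imports "HOL-Probability.Probability" "HOL-Library.Sublist"
begin

definition occurs_in :: "'s list \<Rightarrow> (nat \<Rightarrow> 's) \<Rightarrow> bool" where
  "occurs_in w x \<longleftrightarrow> (\<exists>k. map x [k..<k + length w] = w)"

definition language :: "(nat \<Rightarrow> 's) set \<Rightarrow> 's list set" where
  "language X = {w. \<exists>x\<in>X. occurs_in w x}"

definition cylinder :: "(nat \<Rightarrow> 's) set \<Rightarrow> 's list \<Rightarrow> (nat \<Rightarrow> 's) set" where
  "cylinder X W = {x \<in> X. map x [0..<length W] = W}"

text \<open>The measurable space on \<open>X\<close> generated by the cylinders; over a countable symbol set this
  is the Borel \<open>\<sigma>\<close>-algebra of the product topology restricted to \<open>X\<close>.\<close>

definition cylinder_space :: "(nat \<Rightarrow> 's) set \<Rightarrow> (nat \<Rightarrow> 's) measure" where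
  "cylinder_space X = sigma X (cylinder X ` language X)"


definition reduced_collection :: "'a list set \<Rightarrow> bool" where
  "reduced_collection F \<longleftrightarrow> (\<forall>u\<in>F. \<forall>v\<in>F. u \<noteq> v \<longrightarrow> \<not> sublist u v)"

definition avoiding_shift :: "'a list set \<Rightarrow> (nat \<Rightarrow> 'a) set" where
  "avoiding_shift F = {x. \<forall>w\<in>F. \<not> occurs_in w x}"

definition allowed_words :: "'a list set \<Rightarrow> nat \<Rightarrow> 'a list set" where
  "allowed_words F n = {w \<in> language (avoiding_shift F). length w = n}"

definition irreducible_shift :: "(nat \<Rightarrow> 's) set \<Rightarrow> bool" where
  "irreducible_shift X \<longleftrightarrow> (\<forall>u\<in>language X. \<forall>v\<in>language X. \<exists>w. u @ w @ v \<in> language X)"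

definition block_presentation :: "'a list set \<Rightarrow> nat \<Rightarrow> (nat \<Rightarrow> 'a list) set" where
  "block_presentation F p = (\<lambda>x n. map x [n..<n + p]) ` avoiding_shift F"


text \<open>The partial product \<open>X * Y\<close> of words of length \<open>p - 1 \<ge> 1\<close>. When it is defined,
  \<open>X = butlast (X * Y)\<close> and \<open>Y = tl (X * Y)\<close>.\<close>

definition star_defined :: "'a list \<Rightarrow> 'a list \<Rightarrow> bool" where
  "star_defined X Y \<longleftrightarrow> tl X = butlast Y"

definition star :: "'a list \<Rightarrow> 'a list \<Rightarrow> 'a list" where
  "star X Y = X @ [last Y]"

text \<open>\<open>m\<close> gives the multiplicities of the words in \<open>R\<close>; its values outside \<open>R\<close> are irrelevant.\<close>

definition adjacency_matrix ::
  "'a list set \<Rightarrow> nat \<Rightarrow> 'a list set \<Rightarrow> ('a list \<Rightarrow> nat) \<Rightarrow> 'a list \<Rightarrow> 'a list \<Rightarrow> nat" where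
  "adjacency_matrix F p R m X Y =
     (if star_defined X Y \<and> star X Y \<in> allowed_words F p
      then (if star X Y \<in> R then m (star X Y) else 1)
      else 0)"

definition binary_matrix :: "('v \<Rightarrow> 'v \<Rightarrow> nat) \<Rightarrow> 'v \<Rightarrow> 'v \<Rightarrow> nat" where
  "binary_matrix A X Y = (if A X Y > 0 then 1 else 0)"

text \<open>The triple \<open>(X, Y, i)\<close> is the \<open>i\<close>-th edge from \<open>X\<close> to \<open>Y\<close>.\<close>

definition edges :: "'v set \<Rightarrow> ('v \<Rightarrow> 'v \<Rightarrow> nat) \<Rightarrow> ('v \<times> 'v \<times> nat) set" where
  "edges I B = {(X, Y, i). X \<in> I \<and> Y \<in> I \<and> 1 \<le> i \<and> i \<le> B X Y}"

definition edge_source :: "'v \<times> 'v \<times> nat \<Rightarrow> 'v" where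
  "edge_source = (\<lambda>(X, Y, i). X)"

definition edge_target :: "'v \<times> 'v \<times> nat \<Rightarrow> 'v" where
  "edge_target = (\<lambda>(X, Y, i). Y)"

definition edge_shift :: "'v set \<Rightarrow> ('v \<Rightarrow> 'v \<Rightarrow> nat) \<Rightarrow> (nat \<Rightarrow> 'v \<times> 'v \<times> nat) set" where
  "edge_shift I B =
     {e. \<forall>n. e n \<in> edges I B \<and> edge_target (e n) = edge_source (e (Suc n))}"

definition forget_index :: "(nat \<Rightarrow> 'a list \<times> 'a list \<times> nat) \<Rightarrow> nat \<Rightarrow> 'a list" where
  "forget_index e = (\<lambda>n. star (edge_source (e n)) (edge_target (e n)))"


text \<open>Matrices indexed by a finite set \<open>I\<close> are functions whose values outside \<open>I\<close> are ignored.
  The Perron root is the spectral radius, i.e. the largest modulus of a complex eigenvalue.\<close>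

definition eigenvalues :: "'v set \<Rightarrow> ('v \<Rightarrow> 'v \<Rightarrow> nat) \<Rightarrow> complex set" where
  "eigenvalues I B =
     {l. \<exists>v. (\<exists>X\<in>I. v X \<noteq> 0) \<and> (\<forall>X\<in>I. (\<Sum>Y\<in>I. of_nat (B X Y) * v Y) = l * v X)}"

definition perron_root :: "'v set \<Rightarrow> ('v \<Rightarrow> 'v \<Rightarrow> nat) \<Rightarrow> real" where
  "perron_root I B = (SUP l\<in>eigenvalues I B. cmod l)"

definition right_perron_eigenvector ::
  "'v set \<Rightarrow> ('v \<Rightarrow> 'v \<Rightarrow> nat) \<Rightarrow> ('v \<Rightarrow> real) \<Rightarrow> bool" where
  "right_perron_eigenvector I B V \<longleftrightarrow>
     (\<forall>X\<in>I. V X > 0) \<and>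
     (\<forall>X\<in>I. (\<Sum>Y\<in>I. real (B X Y) * V Y) = perron_root I B * V X)"

definition left_perron_eigenvector ::
  "'v set \<Rightarrow> ('v \<Rightarrow> 'v \<Rightarrow> nat) \<Rightarrow> ('v \<Rightarrow> real) \<Rightarrow> bool" where
  "left_perron_eigenvector I B U \<longleftrightarrow>
     (\<forall>X\<in>I. U X > 0) \<and>
     (\<forall>Y\<in>I. (\<Sum>X\<in>I. U X * real (B X Y)) = perron_root I B * U Y)"

text \<open>\<open>S\<close> is the edge shift of \<open>B\<close>, with the edges named by arbitrary symbols: \<open>src\<close> and \<open>tgt\<close>
  give the initial and terminal vertex of the edge named by a symbol.\<close>

definition shannon_parry_measure ::
  "'v set \<Rightarrow> ('v \<Rightarrow> 'v \<Rightarrow> nat) \<Rightarrow> ('e \<Rightarrow> 'v) \<Rightarrow> ('e \<Rightarrow> 'v) \<Rightarrow> (nat \<Rightarrow> 'e) set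
     \<Rightarrow> (nat \<Rightarrow> 'e) measure \<Rightarrow> bool" where
  "shannon_parry_measure I B src tgt S \<mu> \<longleftrightarrow>
     space \<mu> = S \<and> sets \<mu> = sets (cylinder_space S) \<and>
     (\<exists>U V. left_perron_eigenvector I B U \<and> right_perron_eigenvector I B V \<and>
        (\<Sum>X\<in>I. U X * V X) = 1 \<and>
        (\<forall>W\<in>language S. W \<noteq> [] \<longrightarrow>
           emeasure \<mu> (cylinder S W) =
             ennreal (U (src (hd W)) * V (tgt (last W)) / perron_root I B ^ length W)))"

definition edge_shift_measure ::
  "'v set \<Rightarrow> ('v \<Rightarrow> 'v \<Rightarrow> nat) \<Rightarrow> (nat \<Rightarrow> 'v \<times> 'v \<times> nat) measure \<Rightarrow> bool" where
  "edge_shift_measure I B \<nu> \<longleftrightarrow>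
     shannon_parry_measure I B edge_source edge_target (edge_shift I B) \<nu>"

text \<open>A symbol \<open>X * Y\<close> of the block presentation names the only edge from \<open>X\<close> to \<open>Y\<close> in the
  graph of the binary matrix.\<close>

definition parry_measure ::
  "'a list set \<Rightarrow> nat \<Rightarrow> ('a list \<Rightarrow> 'a list \<Rightarrow> nat) \<Rightarrow> (nat \<Rightarrow> 'a list) measure \<Rightarrow> bool" where
  "parry_measure F p A \<mu> \<longleftrightarrow>
     shannon_parry_measure (allowed_words F (p - 1)) (binary_matrix A) butlast tl
       (block_presentation F p) \<mu>"

end

theory Submission
  imports Defs
begin

text \<open>Here \<open>A\<close> is \<open>M\<close> times its binary matrix, so both have the same Perron eigenvectors and the
  Perron root is multiplied by \<open>M\<close>. A cylinder of the block presentation given by a word of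
  length \<open>n\<close> pulls back to a disjoint union of \<open>M ^ n\<close> cylinders of equal measure, which cancels
  the factor \<open>M ^ n\<close> in the denominator. For the converse, positive eigenvectors of an
  irreducible matrix are unique up to scaling, and measures on the shift space are determined by
  their values on cylinders.\<close>

section \<open>Cylinders\<close>

lemma cylinder_subset: "cylinder X W \<subseteq> X"
  by (auto simp: cylinder_def)

lemma space_cylinder_space [simp]: "space (cylinder_space X) = X"
  by (simp add: cylinder_space_def space_measure_of_conv)

lemma sets_cylinder_space: "sets (cylinder_space X) = sigma_sets X (cylinder X ` language X)"
  using cylinder_subset[of X] unfolding cylinder_space_def by (intro sets_measure_of) blast

lemma cylinder_in_sets: "W \<in> language X \<Longrightarrow> cylinder X W \<in> sets (cylinder_space X)"
  by (auto simp: sets_cylinder_space)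

text \<open>A word determines its prefixes, so two cylinders are either nested or disjoint. This is
  what makes the cylinders closed under intersection.\<close>

lemma Int_cylinder:
  assumes "length U \<le> length W"
  shows "cylinder X U \<inter> cylinder X W = (if take (length U) W = U then cylinder X W else {})"
proof -
  have "map x [0..<length U] = take (length U) (map x [0..<length W])" for x :: "nat \<Rightarrow> 'a"
    using assms by (simp add: take_map)
  then show ?thesis
    by (auto simp: cylinder_def)
qed

text \<open>A uniqueness argument for measures on an intersection-stable generator. Only nonempty
  words are compared, because the Shannon-Parry formula is imposed on those alone; countability of
  the symbols makes the cylinders of length one a countable cover of finite measure.\<close>

lemma measure_eqI_cylinders:
  fixes X :: "(nat \<Rightarrow> 's::countable) set"
  assumes "sets \<mu> = sets (cylinder_space X)" "sets \<nu> = sets (cylinder_space X)"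
    and eq: "\<And>W. W \<in> language X \<Longrightarrow> W \<noteq> [] \<Longrightarrow>
      emeasure \<mu> (cylinder X W) = emeasure \<nu> (cylinder X W)"
    and fin: "\<And>W. W \<in> language X \<Longrightarrow> W \<noteq> [] \<Longrightarrow> emeasure \<mu> (cylinder X W) \<noteq> \<infinity>"
  shows "\<mu> = \<nu>"
proof -
  \<comment> \<open>The empty set is added because disjoint cylinders meet in it. The omitted
    cylinder of the empty word is the whole space \<open>X\<close>, so the generated sigma-algebra
    is unchanged.\<close>
  define E where "E = insert {} (cylinder X ` (language X - {[]}))"
  have EX: "E \<subseteq> Pow X"
    using cylinder_subset[of X] by (auto simp: E_def)
  have gen: "sets (cylinder_space X) = sigma_sets X E"
    unfolding sets_cylinder_space
  proof (rule sigma_sets_eqI)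
    fix a assume "a \<in> cylinder X ` language X"
    then obtain W where W: "a = cylinder X W" "W \<in> language X" by auto
    show "a \<in> sigma_sets X E"
    proof (cases "W = []")
      case True
      then have "a = X" using W by (auto simp: cylinder_def)
      then show ?thesis by (simp add: sigma_sets_top)
    qed (use W in \<open>auto simp: E_def\<close>)
  qed (auto simp: E_def intro: sigma_sets.Empty)
  have stable: "Int_stable E"
  proof (rule Int_stableI)
    have *: "cylinder X U \<inter> cylinder X W \<in> E"
      if "U \<in> language X - {[]}" "W \<in> language X - {[]}" for U W
    proof (cases "length U \<le> length W")
      case True
      then show ?thesis using that by (auto simp: Int_cylinder E_def)
    next
      case False
      then have "cylinder X W \<inter> cylinder X U \<in> E" using that by (auto simp: Int_cylinder E_def)
      then show ?thesis by (simp add: Int_commute)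
    qed
    fix a b assume "a \<in> E" "b \<in> E"
    then show "a \<inter> b \<in> E" using * by (auto simp: E_def)
  qed
  define C where "C = (\<lambda>a. cylinder X [a]) ` {a. [a] \<in> language X}"
  have cover: "\<Union>C = X"
  proof
    show "X \<subseteq> \<Union>C"
    proof
      fix x assume x: "x \<in> X"
      then have "[x 0] \<in> language X"
        by (auto simp: language_def occurs_in_def intro!: bexI[of _ x] exI[of _ 0])
      then show "x \<in> \<Union>C" using x by (auto simp: C_def cylinder_def)
    qed
  qed (auto simp: C_def cylinder_def)
  show ?thesis
  proof (rule measure_eqI_generator_eq_countable[OF stable EX, where A = C])
    show "emeasure \<mu> Y = emeasure \<nu> Y" if "Y \<in> E" for Y
      using that eq by (auto simp: E_def)
    show "emeasure \<mu> a \<noteq> \<infinity>" if "a \<in> C" for a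
      using that fin by (auto simp: C_def)
  qed (use assms(1,2) gen cover in \<open>auto simp: C_def E_def\<close>)
qed


section \<open>Positive eigenvectors\<close>

text \<open>Subtract from \<open>V'\<close> the largest multiple of \<open>V\<close> that leaves a
  nonnegative vector. The difference \<open>Z\<close> satisfies the same eigenvector equation and
  has a zero; nonnegativity carries zeros along edges, and irreducibility carries them to all of
  \<open>I\<close>.\<close>

lemma positive_eigenvector_unique:
  fixes B :: "'v \<Rightarrow> 'v \<Rightarrow> real"
  assumes fin: "finite I" and ne: "I \<noteq> {}" and nonneg: "\<And>X Y. B X Y \<ge> 0"
    and irr: "\<And>X Y. X \<in> I \<Longrightarrow> Y \<in> I \<Longrightarrow> (X, Y) \<in> {(X, Y). X \<in> I \<and> Y \<in> I \<and> B X Y > 0}\<^sup>*"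
    and V: "\<forall>X\<in>I. V X > 0" "\<forall>X\<in>I. (\<Sum>Y\<in>I. B X Y * V Y) = \<theta> * V X"
    and V': "\<forall>X\<in>I. V' X > 0" "\<forall>X\<in>I. (\<Sum>Y\<in>I. B X Y * V' Y) = \<theta> * V' X"
  shows "\<exists>c. \<forall>X\<in>I. V' X = c * V X"
proof -
  define c where "c = Min ((\<lambda>X. V' X / V X) ` I)"
  define Z where "Z X = V' X - c * V X" for X
  have "c \<in> (\<lambda>X. V' X / V X) ` I"
    unfolding c_def using fin ne by (intro Min_in) auto
  then obtain X0 where X0: "X0 \<in> I" "c = V' X0 / V X0" by auto
  have Z0: "Z X0 = 0" using X0 V(1) by (auto simp: Z_def)
  have Zge: "Z X \<ge> 0" if "X \<in> I" for X
  proof -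
    have "c \<le> V' X / V X" unfolding c_def using fin that by (intro Min_le) auto
    then show ?thesis using V(1) that by (simp add: Z_def pos_le_divide_eq)
  qed
  have ZB: "(\<Sum>Y\<in>I. B X Y * Z Y) = \<theta> * Z X" if "X \<in> I" for X
  proof -
    have "(\<Sum>Y\<in>I. B X Y * Z Y) = (\<Sum>Y\<in>I. B X Y * V' Y) - c * (\<Sum>Y\<in>I. B X Y * V Y)"
      by (simp add: Z_def algebra_simps sum_subtractf sum_distrib_left)
    then show ?thesis using that V V' by (simp add: Z_def algebra_simps)
  qed
  have "Z Y = 0" if "Y \<in> I" for Y
    using irr[OF X0(1) that]
  proof (induction rule: rtrancl_induct)
    \<comment> \<open>At a zero \<open>X\<close> of \<open>Z\<close> the row sum is zero with
      nonnegative terms, so every term vanishes; the entry on the edge from \<open>X\<close> to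
      \<open>Y\<close> is positive, which forces \<open>Z Y\<close> to be 0.\<close>
    case (step X Y)
    then have "(\<Sum>Y\<in>I. B X Y * Z Y) = 0" using ZB[of X] by auto
    then have "B X Y * Z Y = 0"
      using step fin Zge nonneg by (subst (asm) sum_nonneg_eq_0_iff) auto
    then show ?case using step by auto
  qed (rule Z0)
  then show ?thesis by (auto simp: Z_def)
qed

text \<open>Evaluated at a coordinate where the eigenvector has largest modulus, the eigenvalue
  equation bounds the modulus of \<open>l\<close> by a row sum, hence by the sum of all entries.
  Boundedness is what makes the supremum in \<open>perron_root\<close> an upper bound.\<close>

lemma bdd_above_eigenvalues:
  assumes fin: "finite I"
  shows "bdd_above (cmod ` eigenvalues I B)"
proof (rule bdd_aboveI2)
  fix l assume "l \<in> eigenvalues I B"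
  then obtain v X0 where X0: "X0 \<in> I" "v X0 \<noteq> 0"
    and ev: "\<And>X. X \<in> I \<Longrightarrow> (\<Sum>Y\<in>I. of_nat (B X Y) * v Y) = l * v X"
    unfolding eigenvalues_def by auto
  have "Max ((\<lambda>Y. cmod (v Y)) ` I) \<in> (\<lambda>Y. cmod (v Y)) ` I"
    using fin X0(1) by (intro Max_in) auto
  then obtain X where X: "X \<in> I" and max: "Max ((\<lambda>Y. cmod (v Y)) ` I) = cmod (v X)"
    by auto
  have X_max: "cmod (v Y) \<le> cmod (v X)" if "Y \<in> I" for Y
    unfolding max[symmetric] using fin that by (intro Max_ge) auto
  have pos: "cmod (v X) > 0" using X_max[OF X0(1)] X0(2)
    by (meson less_le_trans zero_less_norm_iff)
  have "cmod l * cmod (v X) = cmod (\<Sum>Y\<in>I. of_nat (B X Y) * v Y)"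
    using ev[OF X] by (simp add: norm_mult)
  also have "\<dots> \<le> (\<Sum>Y\<in>I. real (B X Y) * cmod (v Y))"
    by (rule sum_norm_le) (simp add: norm_mult)
  also have "\<dots> \<le> (\<Sum>Y\<in>I. real (B X Y) * cmod (v X))"
    by (intro sum_mono mult_left_mono X_max) auto
  also have "\<dots> = (\<Sum>Y\<in>I. real (B X Y)) * cmod (v X)"
    by (simp add: sum_distrib_right)
  finally have "cmod l \<le> (\<Sum>Y\<in>I. real (B X Y))" using pos by simp
  also have "\<dots> \<le> (\<Sum>X\<in>I. \<Sum>Y\<in>I. real (B X Y))"
    using X fin by (intro member_le_sum) (auto intro: sum_nonneg)
  finally show "cmod l \<le> (\<Sum>X\<in>I. \<Sum>Y\<in>I. real (B X Y))" .
qed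

text \<open>Multiplication by \<open>M\<close> maps the eigenvalues of \<open>B\<close> onto those
  of \<open>A\<close>, with the same eigenvectors. The two suprema are then compared in both
  directions; \<open>ne\<close> allows them to be treated as least upper bounds.\<close>

lemma perron_root_scale:
  assumes fin: "finite I" and M: "M > 0" and AB: "\<And>X Y. A X Y = M * B X Y"
    and ne: "eigenvalues I A \<noteq> {}"
  shows "perron_root I A = real M * perron_root I B"
proof -
  have scale: "of_nat M * l \<in> eigenvalues I A" if "l \<in> eigenvalues I B" for l
    using that unfolding eigenvalues_def
    by (auto simp: AB mult.assoc simp flip: sum_distrib_left)
  have unscale: "l / of_nat M \<in> eigenvalues I B" if l: "l \<in> eigenvalues I A" for l
  proof -
    obtain v where v: "\<exists>X\<in>I. v X \<noteq> 0"
      "\<forall>X\<in>I. of_nat M * (\<Sum>Y\<in>I. of_nat (B X Y) * v Y) = l * v X"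
      using l unfolding eigenvalues_def by (auto simp: AB mult.assoc simp flip: sum_distrib_left)
    have "\<forall>X\<in>I. (\<Sum>Y\<in>I. of_nat (B X Y) * v Y) = l / of_nat M * v X"
      using v(2) M by (simp add: eq_divide_eq mult.commute)
    with v(1) show ?thesis unfolding eigenvalues_def by blast
  qed
  have neB: "eigenvalues I B \<noteq> {}" using ne unscale by blast
  show ?thesis
  proof (rule antisym)
    show "perron_root I A \<le> real M * perron_root I B"
      unfolding perron_root_def
    proof (rule cSUP_least[OF ne])
      fix l assume "l \<in> eigenvalues I A"
      from cSUP_upper[OF unscale[OF this] bdd_above_eigenvalues[OF fin]] M
      show "cmod l \<le> real M * (SUP l\<in>eigenvalues I B. cmod l)"
        by (simp add: norm_divide field_simps)
    qed
    have "perron_root I B \<le> perron_root I A / real M"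
      unfolding perron_root_def
    proof (rule cSUP_least[OF neB])
      fix l assume "l \<in> eigenvalues I B"
      from cSUP_upper[OF scale[OF this] bdd_above_eigenvalues[OF fin]] M
      show "cmod l \<le> (SUP l\<in>eigenvalues I A. cmod l) / real M"
        by (simp add: norm_mult field_simps)
    qed
    then show "real M * perron_root I B \<le> perron_root I A"
      using M by (simp add: field_simps)
  qed
qed

text \<open>A positive real eigenvector, read as a complex one, is a witness. This provides the
  nonempty set of eigenvalues that \<open>perron_root_scale\<close> asks for.\<close>

lemma perron_root_in_eigenvalues:
  assumes "I \<noteq> {}" and V: "right_perron_eigenvector I B V"
  shows "of_real (perron_root I B) \<in> eigenvalues I B"
proof -
  have "(\<Sum>Y\<in>I. of_nat (B X Y) * complex_of_real (V Y)) = of_real (perron_root I B) * of_real (V X)"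
    if "X \<in> I" for X
  proof -
    have "complex_of_real (\<Sum>Y\<in>I. real (B X Y) * V Y) = of_real (perron_root I B * V X)"
      using V that by (simp add: right_perron_eigenvector_def)
    then show ?thesis by simp
  qed
  moreover have "\<exists>X\<in>I. complex_of_real (V X) \<noteq> 0"
    using assms by (force simp: right_perron_eigenvector_def)
  ultimately show ?thesis
    unfolding eigenvalues_def by (intro CollectI exI[of _ "\<lambda>X. of_real (V X)"]) auto
qed

lemma perron_eigenvector_scale:
  assumes "M > 0" and AB: "\<And>X Y. A X Y = M * B X Y"
    and root: "perron_root I A = real M * perron_root I B"
  shows "right_perron_eigenvector I A V \<longleftrightarrow> right_perron_eigenvector I B V"
    and "left_perron_eigenvector I A U \<longleftrightarrow> left_perron_eigenvector I B U"
  using assms(1)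
  by (auto simp: right_perron_eigenvector_def left_perron_eigenvector_def AB root mult.assoc
        mult.left_commute[of _ "real M"] simp flip: sum_distrib_left)

text \<open>The eigenvectors themselves are determined only up to factors \<open>d\<close> and
  \<open>c\<close>, but the normalization forces \<open>d * c = 1\<close>, so the products entering
  the Shannon-Parry formula are determined.\<close>

lemma perron_eigenvectors_unique:
  assumes fin: "finite I" and ne: "I \<noteq> {}"
    and irr: "\<And>X Y. X \<in> I \<Longrightarrow> Y \<in> I \<Longrightarrow> (X, Y) \<in> {(X, Y). X \<in> I \<and> Y \<in> I \<and> B X Y > 0}\<^sup>*"
    and U: "left_perron_eigenvector I B U" "left_perron_eigenvector I B U'"
    and V: "right_perron_eigenvector I B V" "right_perron_eigenvector I B V'"
    and norm: "(\<Sum>X\<in>I. U X * V X) = 1" "(\<Sum>X\<in>I. U' X * V' X) = 1"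
    and XY: "X \<in> I" "Y \<in> I"
  shows "U X * V Y = U' X * V' Y"
proof -
  have "\<exists>c. \<forall>X\<in>I. V' X = c * V X"
    using V irr unfolding right_perron_eigenvector_def
    by (intro positive_eigenvector_unique[OF fin ne, of "\<lambda>X Y. real (B X Y)"]) auto
  then obtain c where c: "\<forall>X\<in>I. V' X = c * V X" ..
  \<comment> \<open>A left eigenvector is a right eigenvector of the transpose, whose graph has all
    edges reversed and is therefore also strongly connected.\<close>
  have irr': "(X, Y) \<in> {(X, Y). X \<in> I \<and> Y \<in> I \<and> B Y X > 0}\<^sup>*" if "X \<in> I" "Y \<in> I" for X Y
  proof -
    have "(X, Y) \<in> ({(X, Y). X \<in> I \<and> Y \<in> I \<and> B X Y > 0}\<inverse>)\<^sup>*"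
      using irr[OF that(2,1)] by (simp add: rtrancl_converse)
    also have "{(X, Y). X \<in> I \<and> Y \<in> I \<and> B X Y > 0}\<inverse> = {(X, Y). X \<in> I \<and> Y \<in> I \<and> B Y X > 0}"
      by auto
    finally show ?thesis .
  qed
  have "\<exists>d. \<forall>X\<in>I. U' X = d * U X"
    using U irr' unfolding left_perron_eigenvector_def
    by (intro positive_eigenvector_unique[OF fin ne, of "\<lambda>X Y. real (B Y X)"])
      (auto simp: mult.commute)
  then obtain d where d: "\<forall>X\<in>I. U' X = d * U X" ..
  have "1 = (\<Sum>X\<in>I. (d * c) * (U X * V X))"
    unfolding norm(2)[symmetric] using c d by (intro sum.cong) auto
  then have "d * c = 1" by (simp add: norm(1) flip: sum_distrib_left)
  then have "U' X * V' Y = (d * c) * (U X * V Y)" using c d XY by simp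
  then show ?thesis using \<open>d * c = 1\<close> by simp
qed


section \<open>The edge shift over the block presentation\<close>

lemma language_factor: "u @ v @ w \<in> language X \<Longrightarrow> v \<in> language X"
proof -
  assume "u @ v @ w \<in> language X"
  then obtain x k where x: "x \<in> X" "map x [k..<k + length (u @ v @ w)] = u @ v @ w"
    by (auto simp: language_def occurs_in_def)
  have "map x [k + length u..<k + length u + length v]
      = take (length v) (drop (length u) (map x [k..<k + length (u @ v @ w)]))"
    by (rule nth_equalityI) (auto simp: add.assoc)
  also have "\<dots> = v" unfolding x(2) by simp
  finally show ?thesis
    using x(1) by (auto simp: language_def occurs_in_def)
qed

lemma allowed_words_butlast: "w \<in> allowed_words F p \<Longrightarrow> butlast w \<in> allowed_words F (p - 1)"
  using language_factor[of "[]" "butlast w" "[last w]"]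
  by (cases "w = []") (auto simp: allowed_words_def)

lemma allowed_words_tl: "w \<in> allowed_words F p \<Longrightarrow> tl w \<in> allowed_words F (p - 1)"
  using language_factor[of "[hd w]" "tl w" "[]"]
  by (cases "w = []") (auto simp: allowed_words_def)

lemma star_butlast_tl: "length w \<ge> 2 \<Longrightarrow> star (butlast w) (tl w) = w"
  by (cases w) (auto simp: star_def)

lemma star_defined_butlast_tl: "star_defined (butlast w) (tl w)"
  by (simp add: star_defined_def butlast_tl)

lemma butlast_tl_star:
  assumes "star_defined X Y" "X \<noteq> []" "Y \<noteq> []"
  shows "butlast (star X Y) = X" "tl (star X Y) = Y"
  using assms by (auto simp: star_def star_defined_def)

text \<open>No forbidden word is longer than \<open>p\<close>, so every occurrence of one is visible
  inside a single block. Membership thus reduces to local conditions: each block is allowed and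
  consecutive blocks overlap.\<close>

lemma block_presentation_iff:
  assumes F: "\<forall>w\<in>F. length w \<le> p" and p: "p \<ge> 1"
  shows "t \<in> block_presentation F p \<longleftrightarrow>
    (\<forall>n. t n \<in> allowed_words F p \<and> tl (t n) = butlast (t (Suc n)))"
proof
  assume "t \<in> block_presentation F p"
  then obtain x where x: "x \<in> avoiding_shift F" "t = (\<lambda>n. map x [n..<n + p])"
    by (auto simp: block_presentation_def)
  show "\<forall>n. t n \<in> allowed_words F p \<and> tl (t n) = butlast (t (Suc n))"
  proof (intro allI conjI)
    fix n
    show "t n \<in> allowed_words F p"
      using x by (auto simp: allowed_words_def language_def occurs_in_def intro!: bexI[of _ x])
    show "tl (t n) = butlast (t (Suc n))"
      unfolding x(2) by (rule nth_equalityI) (simp_all add: nth_tl nth_butlast del: upt_Suc)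
  qed
next
  assume t: "\<forall>n. t n \<in> allowed_words F p \<and> tl (t n) = butlast (t (Suc n))"
  have len: "length (t n) = p" for n using t by (auto simp: allowed_words_def)
  \<comment> \<open>The overlap condition moves entry \<open>j\<close> of a block to entry
    \<open>j - 1\<close> of the next one, until after \<open>j\<close> moves it stands in
    front.\<close>
  have nth: "t n ! j = hd (t (n + j))" if "j < p" for n j
    using that
  proof (induction j arbitrary: n)
    case 0
    have "t n \<noteq> []" using len[of n] p by auto
    then show ?case by (simp add: hd_conv_nth)
  next
    case (Suc j)
    have "t n ! Suc j = tl (t n) ! j" using Suc.prems len by (simp add: nth_tl)
    also have "\<dots> = t (Suc n) ! j" using t Suc.prems len by (simp add: nth_butlast)
    finally show ?case using Suc.IH[of "Suc n"] Suc.prems by simp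
  qed
  define x where "x = (\<lambda>n. hd (t n))"
  have tx: "map x [n..<n + p] = t n" for n
    by (rule nth_equalityI) (auto simp: len nth x_def)
  have "x \<in> avoiding_shift F"
    unfolding avoiding_shift_def
  proof (intro CollectI ballI notI)
    fix w assume w: "w \<in> F" "occurs_in w x"
    then obtain k where k: "map x [k..<k + length w] = w" by (auto simp: occurs_in_def)
    \<comment> \<open>The occurrence of \<open>w\<close> at \<open>k\<close> is a prefix of the
      block \<open>t k\<close>, which is allowed; hence \<open>w\<close> would be allowed too,
      although it is forbidden.\<close>
    have "w = take (length w) (t k)"
      using k F w(1) by (simp flip: tx add: take_map)
    then have "[] @ w @ drop (length w) (t k) \<in> language (avoiding_shift F)"
      using t by (simp add: allowed_words_def) (metis append_take_drop_id)
    then have "w \<in> language (avoiding_shift F)" by (rule language_factor)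
    then show False using w(1) by (auto simp: language_def avoiding_shift_def)
  qed
  then show "t \<in> block_presentation F p"
    unfolding block_presentation_def by (intro image_eqI[of _ _ x]) (simp_all add: tx)
qed

lemma adjacency_matrix_uniform:
  assumes "M > 0" and "A = adjacency_matrix F p (allowed_words F p) (\<lambda>_. M)"
  shows "A X Y = M * binary_matrix A X Y"
    and "binary_matrix A X Y > 0 \<longleftrightarrow> star_defined X Y \<and> star X Y \<in> allowed_words F p"
  using assms by (auto simp: binary_matrix_def adjacency_matrix_def)

text \<open>For \<open>p\<close> at least 2 the vertices are nonempty words, so \<open>star\<close>
  and the splitting of \<open>w\<close> into \<open>butlast w\<close> and \<open>tl w\<close> are
  mutually inverse. An edge therefore amounts to an allowed word of length \<open>p\<close> together
  with a free index.\<close>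

lemma edges_uniform_iff:
  assumes "p \<ge> 2" and A: "A = adjacency_matrix F p (allowed_words F p) (\<lambda>_. M)"
  shows "(X, Y, i) \<in> edges (allowed_words F (p - 1)) A \<longleftrightarrow>
    (\<exists>w\<in>allowed_words F p. X = butlast w \<and> Y = tl w \<and> i \<in> {1..M})" (is "?L \<longleftrightarrow> ?R")
proof
  assume ?L
  then have "star_defined X Y" "star X Y \<in> allowed_words F p" "i \<in> {1..M}" "X \<noteq> []" "Y \<noteq> []"
    using assms(1) by (auto simp: edges_def A adjacency_matrix_def allowed_words_def split: if_splits)
  then show ?R using butlast_tl_star[of X Y] by (intro bexI[of _ "star X Y"]) auto
next
  assume ?R
  then obtain w where w: "w \<in> allowed_words F p" "X = butlast w" "Y = tl w" "i \<in> {1..M}" by auto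
  moreover have "star (butlast w) (tl w) = w"
    using w(1) assms(1) by (intro star_butlast_tl) (auto simp: allowed_words_def)
  ultimately show ?L
    by (auto simp: edges_def A adjacency_matrix_def star_defined_butlast_tl
        allowed_words_butlast[simplified] allowed_words_tl[simplified])
qed

section \<open>Lifting points and words through the projection\<close>

definition lift_edge :: "'a list \<Rightarrow> nat \<Rightarrow> 'a list \<times> 'a list \<times> nat" where
  "lift_edge w i = (butlast w, tl w, i)"

text \<open>Together with \<open>lift_edge_in_edge_shift\<close> this presents the edge shift as the
  product of the block presentation with all sequences of indices in \<open>{1..M}\<close>:
  consecutive edges constrain only each other's vertices, never the indices.\<close>

lemma edge_shift_uniformD:
  assumes p: "p \<ge> 2" "\<forall>w\<in>F. length w \<le> p"
    and A: "A = adjacency_matrix F p (allowed_words F p) (\<lambda>_. M)"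
    and e: "e \<in> edge_shift (allowed_words F (p - 1)) A"
  shows "forget_index e \<in> block_presentation F p"
    and "e n = lift_edge (forget_index e n) (snd (snd (e n)))" and "snd (snd (e n)) \<in> {1..M}"
proof -
  have 1: "forget_index e n \<in> allowed_words F p \<and> snd (snd (e n)) \<in> {1..M} \<and>
      e n = lift_edge (forget_index e n) (snd (snd (e n)))" for n
  proof -
    obtain X Y i where en: "e n = (X, Y, i)" by (cases "e n") auto
    then have "(X, Y, i) \<in> edges (allowed_words F (p - 1)) A"
      using e by (simp add: edge_shift_def) (metis en)
    then obtain w where w: "w \<in> allowed_words F p" "X = butlast w" "Y = tl w" "i \<in> {1..M}"
      using edges_uniform_iff[OF p(1) A] by auto
    moreover from w(1) p(1) have "star (butlast w) (tl w) = w"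
      by (intro star_butlast_tl) (auto simp: allowed_words_def)
    ultimately show ?thesis
      by (simp add: forget_index_def en edge_source_def edge_target_def lift_edge_def)
  qed
  then show "e n = lift_edge (forget_index e n) (snd (snd (e n)))" "snd (snd (e n)) \<in> {1..M}"
    by auto
  have "tl (forget_index e n) = butlast (forget_index e (Suc n))" for n
  proof -
    have "edge_target (e n) = edge_source (e (Suc n))" using e by (simp add: edge_shift_def)
    moreover have "edge_target (lift_edge w i) = tl w" "edge_source (lift_edge w i) = butlast w"
      for w :: "'a list" and i by (simp_all add: lift_edge_def edge_target_def edge_source_def)
    ultimately show ?thesis using 1 by metis
  qed
  then show "forget_index e \<in> block_presentation F p"
    using 1 p by (subst block_presentation_iff) auto
qed

lemma lift_edge_in_edge_shift:
  assumes p: "p \<ge> 2" "\<forall>w\<in>F. length w \<le> p"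
    and A: "A = adjacency_matrix F p (allowed_words F p) (\<lambda>_. M)"
    and t: "t \<in> block_presentation F p" and i: "\<And>n. i n \<in> {1..M}"
  shows "(\<lambda>n. lift_edge (t n) (i n)) \<in> edge_shift (allowed_words F (p - 1)) A"
proof -
  have t': "t n \<in> allowed_words F p" "tl (t n) = butlast (t (Suc n))" for n
    using t p block_presentation_iff[OF p(2), of t] by auto
  have "lift_edge (t n) (i n) \<in> edges (allowed_words F (p - 1)) A" for n
    unfolding lift_edge_def edges_uniform_iff[OF p(1) A] using t'(1) i by blast
  then show ?thesis
    by (simp add: edge_shift_def) (simp add: lift_edge_def edge_target_def edge_source_def t'(2))
qed

definition index_lists :: "nat \<Rightarrow> nat \<Rightarrow> nat list set" where
  "index_lists M n = {is. set is \<subseteq> {1..M} \<and> length is = n}"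

lemma finite_index_lists: "finite (index_lists M n)"
  unfolding index_lists_def by (rule finite_lists_length_eq) simp

lemma card_index_lists: "card (index_lists M n) = M ^ n"
  unfolding index_lists_def by (subst card_lists_length_eq) auto

lemma language_block_presentation:
  assumes "W \<in> language (block_presentation F p)" "w \<in> set W"
  shows "length w = p"
proof -
  obtain t k where t: "t \<in> block_presentation F p" "map t [k..<k + length W] = W"
    using assms(1) by (auto simp: language_def occurs_in_def)
  from assms(2) have "w \<in> set (map t [k..<k + length W])" by (simp only: t(2))
  then have "w \<in> range t" by auto
  with t(1) show ?thesis by (auto simp: block_presentation_def)
qed

lemma lift_word_in_language:
  assumes p: "p \<ge> 2" "\<forall>w\<in>F. length w \<le> p" and M: "M > 0"
    and A: "A = adjacency_matrix F p (allowed_words F p) (\<lambda>_. M)"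
    and W: "W \<in> language (block_presentation F p)" and i: "is \<in> index_lists M (length W)"
  shows "map2 lift_edge W is \<in> language (edge_shift (allowed_words F (p - 1)) A)"
proof -
  obtain t k where t: "t \<in> block_presentation F p" "map t [k..<k + length W] = W"
    using W by (auto simp: language_def occurs_in_def)
  \<comment> \<open>The prescribed indices are placed where \<open>W\<close> occurs in
    \<open>t\<close>; outside that window any index will do. After it the value is 1, and before it
    truncated subtraction gives \<open>is ! 0\<close> (or 1 if \<open>W\<close> is empty).\<close>
  define i where "i n = (if n - k < length W then is ! (n - k) else 1)" for n
  have len: "length is = length W" using i by (simp add: index_lists_def)
  have "i n \<in> {1..M}" for n
  proof (cases "n - k < length W")
    case True
    then have "is ! (n - k) \<in> set is" using len by simp
    then show ?thesis using assms(6) True by (auto simp: i_def index_lists_def subset_iff)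
  qed (use M in \<open>auto simp: i_def\<close>)
  from lift_edge_in_edge_shift[OF p A t(1), of i, OF this]
  have e: "(\<lambda>n. lift_edge (t n) (i n)) \<in> edge_shift (allowed_words F (p - 1)) A" .
  have W_nth: "W ! j = t (k + j)" if "j < length W" for j
    using that by (subst t(2)[symmetric]) simp
  have "map (\<lambda>n. lift_edge (t n) (i n)) [k..<k + length W] = map2 lift_edge W is"
    by (rule nth_equalityI) (auto simp: len W_nth i_def)
  then have "occurs_in (map2 lift_edge W is) (\<lambda>n. lift_edge (t n) (i n))"
    unfolding occurs_in_def by (intro exI[of _ k]) (simp add: len)
  with e show ?thesis
    unfolding language_def by blast
qed

text \<open>Fixing the first symbols of the image fixes the first edges up to their indices, so
  there is one cylinder upstairs for each list of indices.\<close>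

lemma forget_index_vimage_cylinder:
  assumes p: "p \<ge> 2" "\<forall>w\<in>F. length w \<le> p"
    and A: "A = adjacency_matrix F p (allowed_words F p) (\<lambda>_. M)"
    and W: "W \<in> language (block_presentation F p)"
  defines "S \<equiv> edge_shift (allowed_words F (p - 1)) A"
  shows "forget_index -` cylinder (block_presentation F p) W \<inter> S =
    (\<Union>is\<in>index_lists M (length W). cylinder S (map2 lift_edge W is))" (is "?L = ?R")
proof
  show "?L \<subseteq> ?R"
  proof
    fix e assume e: "e \<in> ?L"
    then have eS: "e \<in> S" and eW: "map (forget_index e) [0..<length W] = W"
      by (auto simp: cylinder_def)
    note D = edge_shift_uniformD[OF p A eS[unfolded S_def]]
    \<comment> \<open>The list of indices is read off from the path \<open>e\<close> itself.\<close>
    define is' where "is' = map (\<lambda>n. snd (snd (e n))) [0..<length W]"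
    have W_nth: "W ! j = forget_index e j" if "j < length W" for j
      using that by (subst eW[symmetric]) simp
    have "is' \<in> index_lists M (length W)"
      using D(3) by (auto simp: index_lists_def is'_def)
    moreover have "map e [0..<length W] = map2 lift_edge W is'"
      by (rule nth_equalityI) (auto simp: is'_def W_nth D(2)[symmetric])
    then have "e \<in> cylinder S (map2 lift_edge W is')"
      using eS by (simp add: cylinder_def is'_def)
    ultimately show "e \<in> ?R" by blast
  qed
  show "?R \<subseteq> ?L"
  proof
    fix e assume "e \<in> ?R"
    then obtain "is" where i: "is \<in> index_lists M (length W)" and eS: "e \<in> S"
      and eW: "map e [0..<length W] = map2 lift_edge W is"
      by (auto simp: cylinder_def index_lists_def)
    note D = edge_shift_uniformD[OF p A eS[unfolded S_def]]
    have len: "length is = length W" using i by (simp add: index_lists_def)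
    have "forget_index e j = W ! j" if j: "j < length W" for j
    proof -
      have "e j = map e [0..<length W] ! j" using j by simp
      also have "\<dots> = lift_edge (W ! j) (is ! j)" using j len by (simp add: eW)
      finally have "forget_index e j = star (butlast (W ! j)) (tl (W ! j))"
        by (simp add: forget_index_def lift_edge_def edge_source_def edge_target_def)
      also have "\<dots> = W ! j"
        using p language_block_presentation[OF W] j by (intro star_butlast_tl) auto
      finally show ?thesis .
    qed
    then have "map (forget_index e) [0..<length W] = W"
      by (intro nth_equalityI) auto
    then show "e \<in> ?L" using D(1) eS by (auto simp: cylinder_def)
  qed
qed

text \<open>The indices can be recovered from a lifted word, so distinct lists give distinct words
  of equal length, whose cylinders have no common point.\<close>

lemma disjoint_lifted_cylinders:
  "disjoint_family_on (\<lambda>is. cylinder S (map2 lift_edge W is)) (index_lists M (length W))"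
  unfolding disjoint_family_on_def
proof (intro ballI impI equals0I)
  fix i j x
  assume ij: "i \<in> index_lists M (length W)" "j \<in> index_lists M (length W)" "i \<noteq> j"
    and x: "x \<in> cylinder S (map2 lift_edge W i) \<inter> cylinder S (map2 lift_edge W j)"
  have "map2 lift_edge W i = map2 lift_edge W j"
    using ij x by (auto simp: cylinder_def index_lists_def)
  then have "map (\<lambda>e. snd (snd e)) (map2 lift_edge W i) = map (\<lambda>e. snd (snd e)) (map2 lift_edge W j)"
    by simp
  moreover have "map (\<lambda>e. snd (snd e)) (map2 lift_edge W k) = k" if "length k = length W"
    for k using that by (intro nth_equalityI) (auto simp: lift_edge_def)
  ultimately show False using ij by (auto simp: index_lists_def)
qed

section \<open>The push forward and its values on cylinders\<close>

lemma forget_index_measurable: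
  assumes p: "p \<ge> 2" "\<forall>w\<in>F. length w \<le> p" and M: "M > 0"
    and A: "A = adjacency_matrix F p (allowed_words F p) (\<lambda>_. M)"
    and \<nu>: "space \<nu> = edge_shift (allowed_words F (p - 1)) A"
      "sets \<nu> = sets (cylinder_space (edge_shift (allowed_words F (p - 1)) A))"
  shows "forget_index \<in> measurable \<nu> (cylinder_space (block_presentation F p))"
  unfolding cylinder_space_def
proof (rule measurable_measure_of)
  show "cylinder (block_presentation F p) ` language (block_presentation F p)
      \<subseteq> Pow (block_presentation F p)"
    using cylinder_subset by blast
  show "forget_index \<in> space \<nu> \<rightarrow> block_presentation F p"
    using edge_shift_uniformD(1)[OF p A] \<nu>(1) by auto
  fix y assume "y \<in> cylinder (block_presentation F p) ` language (block_presentation F p)"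
  then obtain W where W: "W \<in> language (block_presentation F p)"
    and y: "y = cylinder (block_presentation F p) W" by auto
  show "forget_index -` y \<inter> space \<nu> \<in> sets \<nu>"
    unfolding y \<nu> forget_index_vimage_cylinder[OF p A W]
    by (intro sets.finite_UN finite_index_lists cylinder_in_sets lift_word_in_language[OF p M A W])
qed

text \<open>The formula upstairs sees only the length of a word and its first and last vertices, so
  all lifts of \<open>W\<close> have the same measure \<open>c\<close>. Here \<open>\<theta>\<close>
  stands for the Perron root of the binary matrix.\<close>

lemma emeasure_distr_forget_index:
  assumes p: "p \<ge> 2" "\<forall>w\<in>F. length w \<le> p" and M: "M > 0"
    and A: "A = adjacency_matrix F p (allowed_words F p) (\<lambda>_. M)"
    and \<nu>: "space \<nu> = edge_shift (allowed_words F (p - 1)) A"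
      "sets \<nu> = sets (cylinder_space (edge_shift (allowed_words F (p - 1)) A))"
    and cyl: "\<forall>W\<in>language (edge_shift (allowed_words F (p - 1)) A). W \<noteq> [] \<longrightarrow>
      emeasure \<nu> (cylinder (edge_shift (allowed_words F (p - 1)) A) W) =
        ennreal (U (edge_source (hd W)) * V (edge_target (last W)) / (real M * \<theta>) ^ length W)"
    and W: "W \<in> language (block_presentation F p)" "W \<noteq> []"
  shows "emeasure (distr \<nu> (cylinder_space (block_presentation F p)) forget_index)
      (cylinder (block_presentation F p) W) =
    ennreal (U (butlast (hd W)) * V (tl (last W)) / \<theta> ^ length W)"
proof -
  let ?S = "edge_shift (allowed_words F (p - 1)) A" and ?n = "length W"
  define c where "c = U (butlast (hd W)) * V (tl (last W)) / (real M * \<theta>) ^ ?n"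
  have in_lang: "map2 lift_edge W is \<in> language ?S" if "is \<in> index_lists M ?n" for "is"
    using lift_word_in_language[OF p M A W(1) that] .
  have each: "emeasure \<nu> (cylinder ?S (map2 lift_edge W is)) = ennreal c"
    if i: "is \<in> index_lists M ?n" for "is"
  proof -
    have len: "length is = ?n" using i by (simp add: index_lists_def)
    have ne: "map2 lift_edge W is \<noteq> []" using W(2) len by (cases W; cases "is") auto
    have "is \<noteq> []" using len W(2) by auto
    then have "hd (map2 lift_edge W is) = lift_edge (hd W) (hd is)"
      "last (map2 lift_edge W is) = lift_edge (last W) (last is)"
      using W(2) len by (auto simp: hd_map hd_zip last_map last_zip)
    then show ?thesis
      using cyl in_lang[OF i] ne len
      by (simp add: c_def lift_edge_def edge_source_def edge_target_def)
  qed
  have "emeasure (distr \<nu> (cylinder_space (block_presentation F p)) forget_index)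
      (cylinder (block_presentation F p) W) =
      emeasure \<nu> (forget_index -` cylinder (block_presentation F p) W \<inter> ?S)"
    using forget_index_measurable[OF p M A \<nu>] cylinder_in_sets[OF W(1)]
    by (subst emeasure_distr) (simp_all add: \<nu>(1))
  also have "\<dots> = (\<Sum>is\<in>index_lists M ?n. emeasure \<nu> (cylinder ?S (map2 lift_edge W is)))"
    unfolding forget_index_vimage_cylinder[OF p A W(1)]
    using in_lang by (intro sum_emeasure[symmetric] finite_index_lists disjoint_lifted_cylinders)
      (auto simp: \<nu>(2) intro!: cylinder_in_sets simp del: One_nat_def)
  also have "\<dots> = of_nat (M ^ ?n) * ennreal c"
    using each by (simp add: card_index_lists)
  \<comment> \<open>\<open>ennreal_mult'\<close> asks for nonnegativity of the factor
    \<open>M ^ ?n\<close> alone; the sign of \<open>c\<close> is unconstrained.\<close>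
  also have "\<dots> = ennreal (real (M ^ ?n) * c)"
    by (simp only: ennreal_mult' of_nat_0_le_iff ennreal_of_nat_eq_real_of_nat)
  also have "real (M ^ ?n) * c = U (butlast (hd W)) * V (tl (last W)) / \<theta> ^ ?n"
    using M by (simp add: c_def power_mult_distrib)
  finally show ?thesis .
qed

section \<open>Irreducibility of the vertex graph, and the theorem\<close>

text \<open>Irreducibility joins \<open>X\<close> to \<open>Y\<close> inside one allowed word. A
  window of length \<open>p - 1\<close> sliding along that word traces a path from \<open>X\<close>
  to \<open>Y\<close>, since two consecutive windows together form an allowed word of length
  \<open>p\<close>.\<close>

lemma allowed_words_connected:
  assumes p: "p \<ge> 2" and irr: "irreducible_shift (avoiding_shift F)"
    and XY: "X \<in> allowed_words F (p - 1)" "Y \<in> allowed_words F (p - 1)"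
  shows "(X, Y) \<in> {(X, Y). X \<in> allowed_words F (p - 1) \<and> Y \<in> allowed_words F (p - 1) \<and>
    star_defined X Y \<and> star X Y \<in> allowed_words F p}\<^sup>*" (is "_ \<in> ?E\<^sup>*")
proof -
  let ?L = "language (avoiding_shift F)"
  have path: "(take (p - 1) u, drop (length u - (p - 1)) u) \<in> ?E\<^sup>*"
    if "u \<in> ?L" "length u \<ge> p - 1" for u
    using that
  proof (induction u rule: rev_induct)
    case (snoc a v)
    show ?case
    proof (cases "length v \<ge> p - 1")
      case True
      \<comment> \<open>\<open>w\<close> consists of the last \<open>p\<close> letters of
        \<open>v @ [a]\<close>: it is the edge from the last window of \<open>v\<close> to the last
        window of \<open>v @ [a]\<close>.\<close>
      define w where "w = drop (length v - (p - 1)) v @ [a]"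
      have v: "v \<in> ?L" using snoc.prems language_factor[of "[]" v "[a]"] by simp
      have "take (length v - (p - 1)) v @ w @ [] \<in> ?L" using snoc.prems by (simp add: w_def flip: append_assoc)
      then have "w \<in> ?L" by (rule language_factor)
      then have w: "w \<in> allowed_words F p"
        using True p by (simp add: allowed_words_def w_def)
      have "star (butlast w) (tl w) = w"
        using w p by (intro star_butlast_tl) (auto simp: allowed_words_def)
      then have "(butlast w, tl w) \<in> ?E"
        using w allowed_words_butlast[OF w] allowed_words_tl[OF w]
        by (simp add: star_defined_butlast_tl)
      moreover have "butlast w = drop (length v - (p - 1)) v" by (simp add: w_def)
      moreover have "tl w = drop (length (v @ [a]) - (p - 1)) (v @ [a])"
      proof -
        have "w = drop (length v - (p - 1)) (v @ [a])"
          by (simp add: w_def)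
        then have "tl w = drop (Suc (length v - (p - 1))) (v @ [a])"
          by (simp only: drop_Suc tl_drop)
        then show ?thesis using True by (simp add: Suc_diff_le)
      qed
      moreover have "take (p - 1) (v @ [a]) = take (p - 1) v" using True by simp
      ultimately show ?thesis
        using snoc.IH[OF v True] by (simp add: rtrancl.rtrancl_into_rtrancl)
    next
      case False
      \<comment> \<open>Here the path starts: the word is a single window, both first and last, and
        the empty path suffices.\<close>
      then have "length (v @ [a]) = p - 1" using snoc.prems by simp
      then show ?thesis by (simp del: length_append take_append drop_append)
    qed
  qed auto
  obtain w where w: "X @ w @ Y \<in> ?L"
    using irr XY by (auto simp: irreducible_shift_def allowed_words_def)
  have "take (p - 1) (X @ w @ Y) = X" "drop (length (X @ w @ Y) - (p - 1)) (X @ w @ Y) = Y"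
    using XY by (auto simp: allowed_words_def)
  with path[OF w] XY show ?thesis by (auto simp: allowed_words_def)
qed

theorem theorem7p10:
  fixes F :: "'a::finite list set" and p M :: nat
    and A :: "'a list \<Rightarrow> 'a list \<Rightarrow> nat"
    and \<nu> :: "(nat \<Rightarrow> 'a list \<times> 'a list \<times> nat) measure"
    and \<mu> :: "(nat \<Rightarrow> 'a list) measure"
  assumes "finite F" and "F \<noteq> {}" and "reduced_collection F"
    and "\<forall>w\<in>F. length w \<ge> 2"
    and "\<forall>a. [a] \<in> language (avoiding_shift F)"
    and "irreducible_shift (avoiding_shift F)"
    and "p = Max (length ` F)"
    and "M \<ge> 2"
    and "A = adjacency_matrix F p (allowed_words F p) (\<lambda>_. M)"
    and "edge_shift_measure (allowed_words F (p - 1)) A \<nu>"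
  shows "parry_measure F p A \<mu> \<longleftrightarrow>
    \<mu> = distr \<nu> (cylinder_space (block_presentation F p)) forget_index"
proof -
  let ?T = "block_presentation F p" and ?B = "binary_matrix A"
  let ?D = "distr \<nu> (cylinder_space ?T) forget_index"
  define I where "I = allowed_words F (p - 1)"
  have Fp: "\<forall>w\<in>F. length w \<le> p"
    using assms(1,7) by auto
  have p: "p \<ge> 2"
    using assms(2,4) Fp by (meson all_not_in_conv le_trans)
  have M: "M > 0" using assms(8) by simp
  note A = assms(9)
  have fin: "finite I"
    unfolding I_def allowed_words_def
    using finite_lists_length_eq[of "UNIV :: 'a set" "p - 1"] by (auto intro: rev_finite_subset)
  have ne: "I \<noteq> {}"
  proof -
    obtain x where x: "x \<in> avoiding_shift F"
      using assms(5) by (auto simp: language_def)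
    then have "map x [0..<p - 1] \<in> I"
      by (auto simp: I_def allowed_words_def language_def occurs_in_def
          intro!: bexI[of _ x] exI[of _ 0])
    then show ?thesis by auto
  qed
  note AB = adjacency_matrix_uniform(1)[OF M A]
  have irr: "(X, Y) \<in> {(X, Y). X \<in> I \<and> Y \<in> I \<and> ?B X Y > 0}\<^sup>*" if "X \<in> I" "Y \<in> I" for X Y
    using allowed_words_connected[OF p assms(6) that[unfolded I_def]]
    unfolding adjacency_matrix_uniform(2)[OF M A] I_def .
  obtain U V where U: "left_perron_eigenvector I A U" and V: "right_perron_eigenvector I A V"
    and norm: "(\<Sum>X\<in>I. U X * V X) = 1"
    and \<nu>: "space \<nu> = edge_shift I A" "sets \<nu> = sets (cylinder_space (edge_shift I A))"
    and cyl: "\<forall>W\<in>language (edge_shift I A). W \<noteq> [] \<longrightarrow> emeasure \<nu> (cylinder (edge_shift I A) W) =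
      ennreal (U (edge_source (hd W)) * V (edge_target (last W)) / perron_root I A ^ length W)"
    using assms(10) unfolding edge_shift_measure_def shannon_parry_measure_def I_def by blast
  \<comment> \<open>The eigenvector \<open>V\<close> supplied with \<open>\<nu>\<close> shows that
    \<open>A\<close> has an eigenvalue, so that the Perron roots can be compared.\<close>
  have root: "perron_root I A = real M * perron_root I ?B"
    using perron_root_scale[where A = A and B = ?B, OF fin M AB] perron_root_in_eigenvalues[OF ne V] by blast
  note scale = perron_eigenvector_scale[where A = A and B = ?B, OF M AB root]
  note U' = U[unfolded scale(2)] and V' = V[unfolded scale(1)]
  \<comment> \<open>The push forward satisfies the Parry formula with the same \<open>U\<close> and
    \<open>V\<close> that belong to \<open>\<nu>\<close>, which settles one direction at
    once.\<close>
  have D: "emeasure ?D (cylinder ?T W) =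
      ennreal (U (butlast (hd W)) * V (tl (last W)) / perron_root I ?B ^ length W)"
    if "W \<in> language ?T" "W \<noteq> []" for W
    using emeasure_distr_forget_index[OF p Fp M A _ _ _ that, folded I_def, OF \<nu> cyl[unfolded root]] .
  show ?thesis
  proof
    assume "\<mu> = ?D"
    then show "parry_measure F p A \<mu>"
      unfolding parry_measure_def shannon_parry_measure_def I_def[symmetric]
      using U' V' norm D by auto
  next
    assume "parry_measure F p A \<mu>"
    then obtain U1 V1 where \<mu>: "sets \<mu> = sets (cylinder_space ?T)"
      and U1: "left_perron_eigenvector I ?B U1" and V1: "right_perron_eigenvector I ?B V1"
      and norm1: "(\<Sum>X\<in>I. U1 X * V1 X) = 1"
      and cyl1: "\<forall>W\<in>language ?T. W \<noteq> [] \<longrightarrow> emeasure \<mu> (cylinder ?T W) =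
        ennreal (U1 (butlast (hd W)) * V1 (tl (last W)) / perron_root I ?B ^ length W)"
      unfolding parry_measure_def shannon_parry_measure_def I_def[symmetric] by blast
    show "\<mu> = ?D"
    proof (rule measure_eqI_cylinders[OF \<mu>])
      fix W assume W: "W \<in> language ?T" "W \<noteq> []"
      then obtain t k where t: "t \<in> ?T" "map t [k..<k + length W] = W"
        by (auto simp: language_def occurs_in_def)
      have "t n \<in> allowed_words F p" for n
        using block_presentation_iff[OF Fp, of t] p t(1) by auto
      then have "set (map t [k..<k + length W]) \<subseteq> allowed_words F p"
        by auto
      then have "set W \<subseteq> allowed_words F p"
        unfolding t(2) .
      \<comment> \<open>The eigenvectors of \<open>\<mu>\<close> and of \<open>\<nu>\<close> may
        differ, and their products agree only at indices in \<open>I\<close>; hence the end vertices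
        of \<open>W\<close> must be shown to lie there.\<close>
      then have "butlast (hd W) \<in> I" "tl (last W) \<in> I"
        using W(2) unfolding I_def
        by (intro allowed_words_butlast allowed_words_tl; use hd_in_set last_in_set in blast)+
      with perron_eigenvectors_unique[OF fin ne irr U' U1 V' V1 norm norm1]
      show "emeasure \<mu> (cylinder ?T W) = emeasure ?D (cylinder ?T W)"
        using cyl1 W by (simp add: D)
      show "emeasure \<mu> (cylinder ?T W) \<noteq> \<infinity>"
        using cyl1 W by simp
    qed simp
  qed
qed

end
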